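(* Let $A$ be a real $2\times2$ matrix such that $A+iI$ is invertible and $A$ has no purely imaginary eigenvalue of modulus greater than one. Then there exist constants $\alpha_1,\alpha_2\in(0,1)$, determined by $A$, with the following property. Let $\psi_1,\psi_2\in\mathcal{C}^1(\mathbb{R}^2,\mathbb{R}^2)$ satisfy $\psi_j(0)=0$ and $\|\psi_j(x)-\psi_j(x')\|\le\alpha_j\|x-x'\|$ for all $x,x'\in\mathbb{R}^2$, $j=1,2$, and suppose that the Lipschitz graphs $$\mathscr{L}_1=\{x+i\psi_1(x):x\in\mathbb{R}^2\},\qquad \mathscr{L}_2=\{(A+iI)x+i(A+iI)\psi_2(x):x\in\mathbb{R}^2\}$$ in $\mathbb{C}^2$ intersect only at the origin. Then $\mathscr{L}_1\cup\mathscr{L}_2$ is polynomially convex.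
   Context: A compact set $K\subset\mathbb{C}^n$ is polynomially convex if $K=\widehat K:=\{z\in\mathbb{C}^n:|p(z)|\le\sup_K|p|\ \ \forall p\in\mathbb{C}[z_1,\dots,z_n]\}$. A closed set $M\subset\mathbb{C}^n$ is polynomially convex if there is a sequence $\{K_m\}$ of polynomially convex compact sets with $K_m\subset K_{m+1}$ and $\bigcup_m K_m=M$. Norms on $\mathbb{R}^2$ are Euclidean. *)

theory Defs
  imports "HOL-Analysis.Analysis" "HOL-Library.Poly_Mapping"
begin

text \<open>
  The ring of polynomials in the variables \<open>z $ i\<close> is the monoid algebra over the exponent
  vectors \<open>'n \<Rightarrow>\<^sub>0 nat\<close>, with the ring operations of \<open>Poly_Mapping\<close>.
\<close>

type_synonym 'n cpoly = "('n \<Rightarrow>\<^sub>0 nat) \<Rightarrow>\<^sub>0 complex"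

definition eval_cpoly :: "'n::finite cpoly \<Rightarrow> complex ^ 'n \<Rightarrow> complex" where
  "eval_cpoly p z =
     (\<Sum>a\<in>Poly_Mapping.keys p. Poly_Mapping.lookup p a * (\<Prod>i\<in>UNIV. z $ i ^ Poly_Mapping.lookup a i))"

text \<open>
  The supremum below is meaningful for nonempty compact \<open>K\<close>. For \<open>K = {}\<close> it is an unspecified
  real number, independent of \<open>p\<close>; constant polynomials then show that the hull is empty.
\<close>

definition polynomial_hull :: "(complex ^ 'n::finite) set \<Rightarrow> (complex ^ 'n) set" where
  "polynomial_hull K =
     {z. \<forall>p. cmod (eval_cpoly p z) \<le> (SUP w\<in>K. cmod (eval_cpoly p w))}"

definition polynomially_convex_compact :: "(complex ^ 'n::finite) set \<Rightarrow> bool" where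
  "polynomially_convex_compact K \<longleftrightarrow> compact K \<and> K = polynomial_hull K"

definition polynomially_convex :: "(complex ^ 'n::finite) set \<Rightarrow> bool" where
  "polynomially_convex M \<longleftrightarrow> closed M \<and>
     (\<exists>K :: nat \<Rightarrow> (complex ^ 'n) set.
        (\<forall>m. polynomially_convex_compact (K m) \<and> K m \<subseteq> K (Suc m)) \<and> (\<Union>m. K m) = M)"

definition cvec :: "real ^ 'n \<Rightarrow> complex ^ 'n" where
  "cvec x = (\<chi> i. complex_of_real (x $ i))"

definition cmat :: "real ^ 'n ^ 'm \<Rightarrow> complex ^ 'n ^ 'm" where
  "cmat A = map_matrix complex_of_real A"

definition complex_eigenvalue :: "real ^ 'n ^ 'n \<Rightarrow> complex \<Rightarrow> bool" where
  "complex_eigenvalue A \<mu> \<longleftrightarrow> (\<exists>v. v \<noteq> 0 \<and> cmat A *v v = \<mu> *s v)"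

definition C1_map :: "('a::real_normed_vector \<Rightarrow> 'b::real_normed_vector) \<Rightarrow> bool" where
  "C1_map f \<longleftrightarrow>
     (\<exists>f' :: 'a \<Rightarrow> 'a \<Rightarrow>\<^sub>L 'b.
        (\<forall>x. (f has_derivative blinfun_apply (f' x)) (at x)) \<and> continuous_on UNIV f')"

definition real_graph :: "(real ^ 'n \<Rightarrow> real ^ 'n) \<Rightarrow> (complex ^ 'n) set" where
  "real_graph \<psi> = {cvec x + \<i> *s cvec (\<psi> x) | x. True}"

text \<open>In the next definition \<open>mat \<i>\<close> is the scalar matrix \<open>\<i>I\<close>.\<close>

definition tilted_graph ::
    "real ^ 'n ^ 'n \<Rightarrow> (real ^ 'n \<Rightarrow> real ^ 'n) \<Rightarrow> (complex ^ 'n::finite) set" where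
  "tilted_graph A \<psi> =
     {(cmat A + mat \<i>) *v cvec x + \<i> *s ((cmat A + mat \<i>) *v cvec (\<psi> x)) | x. True}"

end

theory Submission
  imports Defs
begin

text \<open>
  The proof rests on one quadratic polynomial \<open>p(z) = z\<^sup>T S z\<close> with \<open>Re p \<ge> \<gamma> \<bar>z\<bar>\<^sup>2\<close> on the first graph
  and \<open>Re p \<le> - \<gamma> \<bar>z\<bar>\<^sup>2\<close> on the second.

  Writing \<open>S = P + \<i> Q\<close>, the analogous inequalities on the tangent model, the real plane and its image
  under \<open>A + \<i>\<close>, say that \<open>P\<close> and \<open>P + (A\<^sup>T Q + Q A) - A\<^sup>T P A\<close> are positive definite. The spectral
  hypothesis on \<open>A\<close> is what makes this solvable (\<open>lyapunov_stein_matrices\<close>): Lyapunov's equation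
  handles eigenvalues off the imaginary axis, an adapted metric those on it, which have modulus
  below one. Quadratic inequalities are stable in a cone around each plane (\<open>coercive_near_real\<close>), and
  this determines the two Lipschitz constants.

  Compact pieces of a single graph with Lipschitz constant below one are polynomially convex,
  because Gaussian functions centred on the graph peak there
  (\<open>compact_in_graph_polynomially_convex\<close>). Two such pieces are glued along the origin by a version
  of Kallin's lemma (\<open>kallin_union\<close>). Here \<open>p\<close> maps the pieces into the right and the left half plane,
  and \<open>1 / (1 + exp (- N p))\<close> serves as a smoothed indicator of the first piece. It is a uniform
  limit of polynomials since its denominator can be deformed to a constant without zeros
  (\<open>approximable_inverse_path\<close>). Intersecting the union of the graphs with growing balls gives the
  required exhaustion.
\<close>

section \<open>Evaluation of polynomials\<close>

lemma eval_cpoly_superset: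
  assumes "finite S" "Poly_Mapping.keys p \<subseteq> S"
  shows "eval_cpoly p z =
    (\<Sum>a\<in>S. Poly_Mapping.lookup p a * (\<Prod>i\<in>UNIV. z $ i ^ Poly_Mapping.lookup a i))"
  unfolding eval_cpoly_def
  by (rule sum.mono_neutral_left) (use assms in \<open>auto simp: in_keys_iff\<close>)

lemma eval_cpoly_zero [simp]: "eval_cpoly 0 z = 0"
  by (simp add: eval_cpoly_def)

lemma eval_cpoly_single:
  "eval_cpoly (Poly_Mapping.single a c) z = c * (\<Prod>i\<in>UNIV. z $ i ^ Poly_Mapping.lookup a i)"
  by (subst eval_cpoly_superset[of "{a}"]) (auto simp: lookup_single)

lemma eval_cpoly_add: "eval_cpoly (p + q) z = eval_cpoly p z + eval_cpoly q z"
proof -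
  let ?S = "Poly_Mapping.keys p \<union> Poly_Mapping.keys q"
  have "finite ?S" by simp
  moreover have "Poly_Mapping.keys (p + q) \<subseteq> ?S" by (rule keys_add)
  ultimately show ?thesis
    by (simp add: eval_cpoly_superset[of ?S] lookup_add distrib_right sum.distrib)
qed

lemma eval_cpoly_sum: "eval_cpoly (sum f S) z = (\<Sum>s\<in>S. eval_cpoly (f s) z)"
  by (induction S rule: infinite_finite_induct) (auto simp: eval_cpoly_add)

lemma eval_cpoly_mult: "eval_cpoly (p * q) z = eval_cpoly p z * eval_cpoly q z"
proof -
  have expand: "r = (\<Sum>a\<in>Poly_Mapping.keys r. Poly_Mapping.single a (Poly_Mapping.lookup r a))"
    for r :: "'a cpoly"
    by (rule poly_mapping_eqI) (auto simp: lookup_sum lookup_single when_def in_keys_iff)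
  have "p * q = (\<Sum>a\<in>Poly_Mapping.keys p. \<Sum>b\<in>Poly_Mapping.keys q.
      Poly_Mapping.single (a + b) (Poly_Mapping.lookup p a * Poly_Mapping.lookup q b))"
    by (subst expand[of p], subst expand[of q]) (simp add: sum_product mult_single)
  then have "eval_cpoly (p * q) z = (\<Sum>a\<in>Poly_Mapping.keys p. \<Sum>b\<in>Poly_Mapping.keys q.
      Poly_Mapping.lookup p a * Poly_Mapping.lookup q b *
      (\<Prod>i\<in>UNIV. z $ i ^ Poly_Mapping.lookup (a + b) i))"
    by (simp add: eval_cpoly_sum eval_cpoly_single)
  then show ?thesis
    by (simp add: eval_cpoly_def sum_product lookup_add power_add prod.distrib mult_ac)
qed

lemma eval_cpoly_const: "eval_cpoly (Poly_Mapping.single 0 c) z = c"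
  by (simp add: eval_cpoly_single)

lemma eval_cpoly_coord:
  "eval_cpoly (Poly_Mapping.single (Poly_Mapping.single i 1) 1) z = z $ i"
proof -
  have "(\<Prod>j\<in>UNIV. z $ j ^ Poly_Mapping.lookup (Poly_Mapping.single i (1::nat)) j) =
      (\<Prod>j\<in>UNIV. if j = i then z $ i else 1)"
    by (rule prod.cong) (auto simp: lookup_single when_def)
  then show ?thesis by (simp add: eval_cpoly_single)
qed

lemma continuous_on_eval_cpoly: "continuous_on Y (eval_cpoly p)"
  unfolding eval_cpoly_def by (intro continuous_intros)

section \<open>Uniform approximation by polynomials\<close>

text \<open>
  For compact \<open>Y\<close> these functions form the closed algebra usually written \<open>P(Y)\<close>; values outside
  \<open>Y\<close> are irrelevant.
\<close>
definition approximable :: "(complex ^ 'n::finite) set \<Rightarrow> (complex ^ 'n \<Rightarrow> complex) \<Rightarrow> bool" where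
  "approximable Y f \<longleftrightarrow> (\<forall>\<epsilon>>0. \<exists>p. \<forall>y\<in>Y. cmod (f y - eval_cpoly p y) < \<epsilon>)"

lemma approximable_cong: "(\<And>y. y \<in> Y \<Longrightarrow> f y = g y) \<Longrightarrow> approximable Y f \<longleftrightarrow> approximable Y g"
  by (simp add: approximable_def)

lemma approximable_eval: "approximable Y (eval_cpoly p)"
  by (auto simp: approximable_def intro: exI[of _ p])

lemma approximable_const: "approximable Y (\<lambda>_. c)"
  using approximable_eval[of Y "Poly_Mapping.single 0 c"] by (simp add: eval_cpoly_const[abs_def])

lemma approximable_coord: "approximable Y (\<lambda>z. z $ i)"
  using approximable_eval[of Y "Poly_Mapping.single (Poly_Mapping.single i 1) 1"]
  by (simp only: eval_cpoly_coord[abs_def])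

lemma approximable_uniform_limit:
  assumes "\<And>n. approximable Y (g n)" "uniform_limit Y g f sequentially"
  shows "approximable Y f"
  unfolding approximable_def
proof (intro allI impI)
  fix \<epsilon> :: real assume "\<epsilon> > 0"
  then obtain n where n: "\<forall>y\<in>Y. dist (g n y) (f y) < \<epsilon> / 2"
    using assms(2) unfolding uniform_limit_sequentially_iff by (meson half_gt_zero le_refl)
  obtain p where p: "\<forall>y\<in>Y. cmod (g n y - eval_cpoly p y) < \<epsilon> / 2"
    using assms(1)[of n] \<open>\<epsilon> > 0\<close> unfolding approximable_def by (meson half_gt_zero)
  have "cmod (f y - eval_cpoly p y) < \<epsilon>" if "y \<in> Y" for y
  proof -
    have "dist (g n y) (f y) < \<epsilon> / 2" "dist (g n y) (eval_cpoly p y) < \<epsilon> / 2"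
      using n p that by (auto simp: dist_norm)
    then have "dist (f y) (eval_cpoly p y) < \<epsilon>" by (rule dist_triangle_half_r)
    then show ?thesis by (simp add: dist_norm)
  qed
  then show "\<exists>p. \<forall>y\<in>Y. cmod (f y - eval_cpoly p y) < \<epsilon>" by blast
qed

lemma approximable_bounded:
  assumes "approximable Y f" "compact Y"
  obtains B where "B \<ge> 0" "\<And>y. y \<in> Y \<Longrightarrow> cmod (f y) \<le> B"
proof -
  obtain p where p: "\<forall>y\<in>Y. cmod (f y - eval_cpoly p y) < 1"
    using assms(1) unfolding approximable_def by (meson zero_less_one)
  have "bounded (eval_cpoly p ` Y)"
    using assms(2) by (intro compact_imp_bounded compact_continuous_image continuous_on_eval_cpoly)
  then obtain C where C: "C > 0" "\<forall>y\<in>Y. cmod (eval_cpoly p y) \<le> C"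
    by (auto simp: bounded_pos)
  show thesis
  proof (rule that[of "C + 1"])
    show "cmod (f y) \<le> C + 1" if "y \<in> Y" for y
      using C(2) p that norm_triangle_sub[of "f y" "eval_cpoly p y"] by fastforce
  qed (use C in simp)
qed

lemma approximable_add:
  assumes "approximable Y f" "approximable Y g"
  shows "approximable Y (\<lambda>z. f z + g z)"
  unfolding approximable_def
proof (intro allI impI)
  fix \<epsilon> :: real assume "\<epsilon> > 0"
  then obtain p q where p: "\<forall>y\<in>Y. cmod (f y - eval_cpoly p y) < \<epsilon> / 2"
      and q: "\<forall>y\<in>Y. cmod (g y - eval_cpoly q y) < \<epsilon> / 2"
    using assms unfolding approximable_def by (meson half_gt_zero)
  have "cmod (f y + g y - eval_cpoly (p + q) y) < \<epsilon>" if "y \<in> Y" for y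
    using p q that norm_diff_triangle_ineq[of "f y" "g y" "eval_cpoly p y" "eval_cpoly q y"]
    by (force simp: eval_cpoly_add)
  then show "\<exists>p. \<forall>y\<in>Y. cmod (f y + g y - eval_cpoly p y) < \<epsilon>" by blast
qed

lemma approximable_mult:
  assumes "approximable Y f" "approximable Y g" "compact Y"
  shows "approximable Y (\<lambda>z. f z * g z)"
  unfolding approximable_def
proof (intro allI impI)
  fix \<epsilon> :: real assume "\<epsilon> > 0"
  obtain B where B: "B \<ge> 0" "\<And>y. y \<in> Y \<Longrightarrow> cmod (f y) \<le> B"
    using approximable_bounded[OF assms(1,3)] by blast
  obtain C where C: "C \<ge> 0" "\<And>y. y \<in> Y \<Longrightarrow> cmod (g y) \<le> C"
    using approximable_bounded[OF assms(2,3)] by blast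
  define \<delta> where "\<delta> = min 1 (\<epsilon> / (B + C + 2))"
  have \<delta>: "\<delta> > 0" "\<delta> \<le> 1" "\<delta> * (B + C + 2) \<le> \<epsilon>"
  proof -
    have "B + C + 2 > 0" using B(1) C(1) by simp
    then show "\<delta> > 0" "\<delta> \<le> 1" "\<delta> * (B + C + 2) \<le> \<epsilon>"
      using \<open>\<epsilon> > 0\<close> by (auto simp: \<delta>_def simp flip: pos_le_divide_eq)
  qed
  obtain p q where p: "\<forall>y\<in>Y. cmod (f y - eval_cpoly p y) < \<delta>"
      and q: "\<forall>y\<in>Y. cmod (g y - eval_cpoly q y) < \<delta>"
    using assms \<delta>(1) unfolding approximable_def by meson
  have "cmod (f y * g y - eval_cpoly (p * q) y) < \<epsilon>" if y: "y \<in> Y" for y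
  proof -
    have q1: "cmod (eval_cpoly q y) \<le> C + 1"
      using C(2)[OF y] bspec[OF q y] \<delta>(2) norm_triangle_ineq2[of "eval_cpoly q y" "g y"]
      by (simp add: norm_minus_commute)
    have "f y * g y - eval_cpoly (p * q) y =
        f y * (g y - eval_cpoly q y) + (f y - eval_cpoly p y) * eval_cpoly q y"
      by (simp add: eval_cpoly_mult algebra_simps)
    then have "cmod (f y * g y - eval_cpoly (p * q) y) \<le>
        cmod (f y) * cmod (g y - eval_cpoly q y) + cmod (f y - eval_cpoly p y) * cmod (eval_cpoly q y)"
      by (metis norm_triangle_ineq norm_mult)
    also have "\<dots> \<le> B * \<delta> + \<delta> * (C + 1)"
      using B C y q1 p q \<delta> by (intro add_mono mult_mono) (auto intro: less_imp_le)
    also have "\<dots> < \<delta> * (B + C + 2)" using \<delta>(1) by (simp add: algebra_simps)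
    finally show ?thesis using \<delta>(3) by simp
  qed
  then show "\<exists>p. \<forall>y\<in>Y. cmod (f y * g y - eval_cpoly p y) < \<epsilon>" by blast
qed

lemma approximable_uminus:
  assumes "approximable Y f" "compact Y"
  shows "approximable Y (\<lambda>z. - f z)"
  using approximable_mult[OF approximable_const[of _ "-1"] assms] by simp

lemma approximable_diff:
  assumes "approximable Y f" "approximable Y g" "compact Y"
  shows "approximable Y (\<lambda>z. f z - g z)"
  using approximable_add[OF assms(1) approximable_uminus[OF assms(2,3)]] by simp

lemma approximable_power:
  assumes "approximable Y f" "compact Y"
  shows "approximable Y (\<lambda>z. f z ^ k)"
  by (induction k) (auto intro: approximable_const approximable_mult assms)

lemma approximable_sum:
  assumes "\<And>s. s \<in> S \<Longrightarrow> approximable Y (f s)"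
  shows "approximable Y (\<lambda>z. \<Sum>s\<in>S. f s z)"
  using assms
  by (induction S rule: infinite_finite_induct) (auto intro: approximable_const approximable_add)

lemma approximable_power_series:
  assumes "approximable Y f" "compact Y" "\<And>y. y \<in> Y \<Longrightarrow> cmod (f y) \<le> B"
    and "summable (\<lambda>k. cmod (a k) * B ^ k)"
  shows "approximable Y (\<lambda>z. suminf (\<lambda>k. a k * f z ^ k))"
proof (rule approximable_uniform_limit)
  show "uniform_limit Y (\<lambda>n z. \<Sum>k<n. a k * f z ^ k) (\<lambda>z. suminf (\<lambda>k. a k * f z ^ k)) sequentially"
    by (rule Weierstrass_m_test[OF _ assms(4)])
       (auto simp: norm_mult norm_power intro!: mult_left_mono power_mono assms(3))
  show "approximable Y (\<lambda>z. \<Sum>k<n. a k * f z ^ k)" for n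
    by (intro approximable_sum approximable_mult approximable_const approximable_power assms(1,2))
qed

lemma approximable_exp:
  assumes "approximable Y f" "compact Y"
  shows "approximable Y (\<lambda>z. exp (f z))"
proof -
  obtain B where B: "B \<ge> 0" "\<And>y. y \<in> Y \<Longrightarrow> cmod (f y) \<le> B"
    using approximable_bounded[OF assms] by blast
  have "approximable Y (\<lambda>z. suminf (\<lambda>k. of_real (inverse (fact k)) * f z ^ k))"
    by (rule approximable_power_series[OF assms B(2)])
       (use summable_exp[of B] in \<open>auto simp: norm_inverse simp del: of_real_inverse\<close>)
  then show ?thesis by (simp add: exp_def scaleR_conv_of_real)
qed

section \<open>Hulls and inverses of approximable functions\<close>

lemma bdd_above_cmod_eval_cpoly:
  "compact K \<Longrightarrow> bdd_above ((\<lambda>w. cmod (eval_cpoly p w)) ` K)"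
  by (intro compact_imp_bounded bounded_imp_bdd_above compact_continuous_image
      continuous_on_norm continuous_on_eval_cpoly)

text \<open>
  The reason for approximating on \<open>insert z0 X\<close>: polynomials that converge uniformly on \<open>X\<close> also
  converge at \<open>z0\<close>, so that the hull inequality passes to the limit.
\<close>
lemma approximable_bound_on_hull:
  assumes "z0 \<in> polynomial_hull X" "compact X" "X \<noteq> {}"
    and f: "approximable (insert z0 X) f" and r: "\<And>x. x \<in> X \<Longrightarrow> cmod (f x) \<le> r"
  shows "cmod (f z0) \<le> r"
proof (rule field_le_epsilon)
  fix \<epsilon> :: real assume "\<epsilon> > 0"
  then obtain p where p: "\<forall>y\<in>insert z0 X. cmod (f y - eval_cpoly p y) < \<epsilon> / 2"
    using f unfolding approximable_def by (meson half_gt_zero)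
  have "(SUP w\<in>X. cmod (eval_cpoly p w)) \<le> r + \<epsilon> / 2"
  proof (rule cSUP_least[OF assms(3)])
    fix x assume x: "x \<in> X"
    have "cmod (eval_cpoly p x) \<le> cmod (f x) + cmod (f x - eval_cpoly p x)"
      using norm_triangle_sub[of "eval_cpoly p x" "f x"] by (simp add: norm_minus_commute)
    then show "cmod (eval_cpoly p x) \<le> r + \<epsilon> / 2" using p r[OF x] x by fastforce
  qed
  moreover have "cmod (eval_cpoly p z0) \<le> (SUP w\<in>X. cmod (eval_cpoly p w))"
    using assms(1) by (simp add: polynomial_hull_def)
  moreover have "cmod (f z0) \<le> cmod (eval_cpoly p z0) + cmod (f z0 - eval_cpoly p z0)"
    by (rule norm_triangle_sub)
  moreover have "cmod (f z0 - eval_cpoly p z0) < \<epsilon> / 2" using p by simp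
  ultimately show "cmod (f z0) \<le> r + \<epsilon>" by linarith
qed

lemma subset_polynomial_hull: "compact K \<Longrightarrow> K \<subseteq> polynomial_hull K"
  by (auto simp: polynomial_hull_def intro!: cSUP_upper bdd_above_cmod_eval_cpoly)

lemma polynomially_convex_compactI:
  assumes "compact K" "\<And>z. z \<in> polynomial_hull K \<Longrightarrow> z \<in> K"
  shows "polynomially_convex_compact K"
  using assms subset_polynomial_hull unfolding polynomially_convex_compact_def by blast

text \<open>
  With \<open>h = (f - g) / f\<close> one has \<open>g = f (1 - h)\<close> and \<open>\<bar>h\<bar> \<le> 1/2\<close> on \<open>X\<close>. The hull inequality extends
  the latter bound to \<open>z0\<close>, and the geometric series of \<open>h\<close> gives the inverse. The
  closeness of \<open>g\<close> to \<open>f\<close> is therefore assumed on \<open>X\<close> alone.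
\<close>
lemma approximable_inverse_perturb:
  assumes "z0 \<in> polynomial_hull X" "compact X" "X \<noteq> {}"
  defines "Y \<equiv> insert z0 X"
  assumes f: "approximable Y f" and g: "approximable Y g" and fi: "approximable Y (\<lambda>z. inverse (f z))"
    and nz: "\<And>y. y \<in> Y \<Longrightarrow> f y \<noteq> 0"
    and near: "\<And>x. x \<in> X \<Longrightarrow> cmod (f x - g x) \<le> cmod (f x) / 2"
  shows "approximable Y (\<lambda>z. inverse (g z)) \<and> (\<forall>y\<in>Y. g y \<noteq> 0)"
proof -
  have Y: "compact Y" using assms by simp
  define h where "h z = (f z - g z) * inverse (f z)" for z
  have h: "approximable Y h"
    unfolding h_def by (intro approximable_mult approximable_diff f g fi Y)
  have hX: "cmod (h x) \<le> 1 / 2" if "x \<in> X" for x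
    using near[OF that] nz[of x] that
    by (auto simp: h_def Y_def norm_divide divide_le_eq simp flip: divide_inverse)
  have hY: "cmod (h y) \<le> 1 / 2" if "y \<in> Y" for y
    using that hX approximable_bound_on_hull[OF assms(1-3) h[unfolded Y_def] hX] by (auto simp: Y_def)
  have g_eq: "g y = f y * (1 - h y)" if "y \<in> Y" for y
    using nz[OF that] by (simp add: h_def field_simps)
  have h1: "h y \<noteq> 1" if "y \<in> Y" for y using hY[OF that] by auto
  have "approximable Y (\<lambda>z. suminf (\<lambda>k. 1 * h z ^ k))"
    by (rule approximable_power_series[OF h Y hY]) (auto intro: summable_geometric)
  then have "approximable Y (\<lambda>z. inverse (f z) * suminf (\<lambda>k. 1 * h z ^ k))"
    by (intro approximable_mult fi Y)
  moreover have "inverse (f y) * suminf (\<lambda>k. 1 * h y ^ k) = inverse (g y)" if "y \<in> Y" for y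
  proof -
    have "suminf (\<lambda>k. h y ^ k) = 1 / (1 - h y)"
      using hY[OF that] by (intro suminf_geometric) auto
    then show ?thesis using g_eq[OF that] by (simp add: field_simps)
  qed
  ultimately have "approximable Y (\<lambda>z. inverse (g z))"
    using approximable_cong[of Y] by (metis (mono_tags, lifting))
  moreover have "\<forall>y\<in>Y. g y \<noteq> 0" using g_eq h1 nz by auto
  ultimately show ?thesis by blast
qed

text \<open>
  This is the substitute for Runge's theorem: instead of moving the poles of a rational function to
  infinity, a function is deformed to an invertible one without acquiring zeros on \<open>X\<close>. By
  compactness \<open>\<bar>F\<bar>\<close> is bounded below along the path, and finitely many perturbation steps suffice.
  That \<open>F T\<close> does not vanish at the hull point \<open>z0\<close> is part of the conclusion.
\<close>
lemma approximable_inverse_path: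
  fixes F :: "real \<Rightarrow> complex ^ 'n::finite \<Rightarrow> complex"
  assumes hull: "z0 \<in> polynomial_hull X" "compact X" "X \<noteq> {}"
  defines "Y \<equiv> insert z0 X"
  assumes cont: "continuous_on ({0..T} \<times> X) (\<lambda>(t, x). F t x)" and "T \<ge> 0"
    and F: "\<And>t. t \<in> {0..T} \<Longrightarrow> approximable Y (F t)"
    and nz: "\<And>t x. t \<in> {0..T} \<Longrightarrow> x \<in> X \<Longrightarrow> F t x \<noteq> 0"
    and start: "approximable Y (\<lambda>z. inverse (F 0 z))" "F 0 z0 \<noteq> 0"
  shows "approximable Y (\<lambda>z. inverse (F T z)) \<and> (\<forall>y\<in>Y. F T y \<noteq> 0)"
proof -
  let ?C = "{0..T} \<times> X"
  have C: "compact ?C" using hull by (intro compact_Times) auto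
  have ne: "?C \<noteq> {}" using hull \<open>T \<ge> 0\<close> by auto
  have "continuous_on ?C (\<lambda>s. cmod (case s of (t, x) \<Rightarrow> F t x))"
    by (intro continuous_on_norm cont)
  then obtain s0 where s0: "s0 \<in> ?C"
      "\<And>s. s \<in> ?C \<Longrightarrow> cmod (case s0 of (t, x) \<Rightarrow> F t x) \<le> cmod (case s of (t, x) \<Rightarrow> F t x)"
    using continuous_attains_inf[OF C ne] by blast
  define c where "c = cmod (case s0 of (t, x) \<Rightarrow> F t x)"
  have c: "c > 0" "\<And>t x. t \<in> {0..T} \<Longrightarrow> x \<in> X \<Longrightarrow> c \<le> cmod (F t x)"
    using s0 nz by (force simp: c_def)+
  obtain \<delta> where \<delta>: "\<delta> > 0" and unif: "\<And>s s'. s \<in> ?C \<Longrightarrow> s' \<in> ?C \<Longrightarrow> dist s' s < \<delta> \<Longrightarrow>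
      dist (case s' of (t, x) \<Rightarrow> F t x) (case s of (t, x) \<Rightarrow> F t x) < c / 2"
    using compact_uniformly_continuous[OF cont C] c(1) unfolding uniformly_continuous_on_def
    by (meson half_gt_zero)
  obtain n where n: "n > 0" "T / real n < \<delta>"
  proof -
    obtain n where "T / \<delta> < real n" using reals_Archimedean2 by blast
    moreover have "n > 0"
    proof (rule ccontr)
      assume "\<not> n > 0"
      moreover have "T / \<delta> \<ge> 0" using \<delta> \<open>T \<ge> 0\<close> by simp
      ultimately show False using \<open>T / \<delta> < real n\<close> by simp
    qed
    ultimately show thesis using that[of n] \<delta> by (simp add: field_simps)
  qed
  define t where "t k = T * real k / real n" for k
  have t: "t k \<in> {0..T}" if "k \<le> n" for k
    using that n(1) \<open>T \<ge> 0\<close> by (auto simp: t_def field_simps intro: mult_left_mono)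
  have "approximable Y (\<lambda>z. inverse (F (t k) z)) \<and> (\<forall>y\<in>Y. F (t k) y \<noteq> 0)" if "k \<le> n" for k
    using that
  proof (induction k)
    case 0
    then show ?case using start nz[of 0] \<open>T \<ge> 0\<close> by (auto simp: t_def Y_def)
  next
    case (Suc k)
    show ?case
    proof (rule approximable_inverse_perturb[OF hull, folded Y_def])
      show "approximable Y (F (t k))" "approximable Y (F (t (Suc k)))"
        using Suc t by (auto intro: F)
      show "approximable Y (\<lambda>z. inverse (F (t k) z))" "\<And>y. y \<in> Y \<Longrightarrow> F (t k) y \<noteq> 0"
        using Suc by auto
      fix x assume x: "x \<in> X"
      have "t (Suc k) - t k = T / real n" using n(1) by (simp add: t_def field_simps)
      moreover have "T / real n \<ge> 0" using \<open>T \<ge> 0\<close> by simp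
      ultimately have "\<bar>t k - t (Suc k)\<bar> < \<delta>" using n(2) by linarith
      then have "dist (t k, x) (t (Suc k), x) < \<delta>"
        by (simp add: dist_Pair_Pair dist_real_def)
      then have "dist (F (t k) x) (F (t (Suc k)) x) < c / 2"
        using unif[of "(t (Suc k), x)" "(t k, x)"] x t Suc.prems by auto
      moreover have "c \<le> cmod (F (t k) x)" using c(2) x t Suc.prems by auto
      ultimately show "cmod (F (t k) x - F (t (Suc k)) x) \<le> cmod (F (t k) x) / 2"
        by (simp add: dist_norm)
    qed
  qed
  from this[of n] n(1) show ?thesis by (simp add: t_def)
qed

section \<open>A Kallin lemma for parts touching at the origin\<close>

lemma one_plus_exp_left:
  "cmod (1 + exp (- w)) \<ge> exp (- Re w) - 1"
  using norm_triangle_ineq2[of "exp (- w)" "-1"] by (simp add: add.commute)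

lemma one_plus_exp_right:
  "cmod (1 + exp (- w)) \<ge> 1 - exp (- Re w)"
  using norm_triangle_ineq2[of "1::complex" "- exp (- w)"] by simp

lemma one_plus_exp_nonzero:
  assumes "Re w \<noteq> 0 \<or> w = 0" shows "1 + exp (- w) \<noteq> (0::complex)"
proof
  assume "1 + exp (- w) = 0"
  then have e: "exp (- w) = - 1" by (simp add: add_eq_0_iff)
  then have "cmod (exp (- w)) = 1" by simp
  then have "Re w = 0" by simp
  then show False using assms e by auto
qed

text \<open>
  Suppose \<open>z0\<close> lies in the hull but not in \<open>X1\<close>. Some polynomial \<open>g\<close> has \<open>g z0 = 1\<close> and \<open>\<bar>g\<bar> \<le> \<rho> < 1\<close>
  on \<open>X1\<close>. Its powers are small on \<open>X1\<close> but may be large on \<open>X2\<close>, where they are multiplied by the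
  logistic factor \<open>1 / (1 + exp (- N P))\<close>, which is small where \<open>Re P\<close> is negative and close to
  one where \<open>Re P\<close> is positive. These estimates degenerate at the origin, common to \<open>X1\<close> and \<open>X2\<close>; the
  factor \<open>(z $ i)\<^sup>2\<close> compensates this, because \<open>\<bar>Re P\<bar>\<close> dominates \<open>\<bar>z\<bar>\<^sup>2\<close>. The product
  \<open>f = g ^ m * (z $ i)\<^sup>2 / (1 + exp (- N P))\<close>, with \<open>m\<close> chosen first and \<open>N\<close> afterwards, is smaller on
  the union than at \<open>z0\<close>.

  The logistic factor is approximable by deforming \<open>N\<close> to \<open>0\<close>: the zeros of \<open>1 + exp (- t w)\<close> lie on
  the imaginary axis away from \<open>0\<close>, which the values of \<open>P\<close> on the union avoid.
\<close>
lemma hull_point_in_one_part: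
  fixes X1 X2 :: "(complex ^ 'n::finite) set" and P :: "'n cpoly"
  assumes X1: "polynomially_convex_compact X1" and X2: "compact X2" and "0 \<in> X1" "0 \<in> X2"
    and c: "c > 0" and P0: "eval_cpoly P 0 = 0"
    and right: "\<And>z. z \<in> X1 \<Longrightarrow> Re (eval_cpoly P z) \<ge> c * (norm z)\<^sup>2"
    and left: "\<And>z. z \<in> X2 \<Longrightarrow> Re (eval_cpoly P z) \<le> - c * (norm z)\<^sup>2"
    and z0: "z0 \<in> polynomial_hull (X1 \<union> X2)" "Re (eval_cpoly P z0) \<ge> 0"
  shows "z0 \<in> X1"
proof (rule ccontr)
  assume notin: "z0 \<notin> X1"
  let ?p = "eval_cpoly P"
  define X where "X = X1 \<union> X2"
  define Y where "Y = insert z0 X"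
  have cX1: "compact X1" and hX1: "X1 = polynomial_hull X1"
    using X1 by (auto simp: polynomially_convex_compact_def)
  have hull: "z0 \<in> polynomial_hull X" "compact X" "X \<noteq> {}"
    using z0 cX1 X2 \<open>0 \<in> X1\<close> by (auto simp: X_def)
  have Y: "compact Y" using hull by (simp add: Y_def)
  have "z0 \<noteq> 0" using notin \<open>0 \<in> X1\<close> by auto
  then obtain i where i: "z0 $ i \<noteq> 0" by (auto simp: vec_eq_iff)
  obtain q where q: "cmod (eval_cpoly q z0) > (SUP w\<in>X1. cmod (eval_cpoly q w))"
    using notin by (subst (asm) hX1) (auto simp: polynomial_hull_def not_le)
  define \<rho> where "\<rho> = (SUP w\<in>X1. cmod (eval_cpoly q w)) / cmod (eval_cpoly q z0)"
  have SUPq: "cmod (eval_cpoly q w) \<le> (SUP w\<in>X1. cmod (eval_cpoly q w))" if "w \<in> X1" for w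
    by (intro cSUP_upper that bdd_above_cmod_eval_cpoly cX1)
  have q0: "cmod (eval_cpoly q z0) > 0"
    using q SUPq[OF \<open>0 \<in> X1\<close>] norm_ge_zero[of "eval_cpoly q 0"] by linarith
  define g where "g z = eval_cpoly q z / eval_cpoly q z0" for z
  have g_approx: "approximable Y g"
    using approximable_mult[OF approximable_eval[of Y q] approximable_const[of Y "inverse (eval_cpoly q z0)"] Y]
    by (simp add: g_def[abs_def] divide_inverse)
  have g0: "g z0 = 1" using q0 by (simp add: g_def)
  have g1: "cmod (g z) \<le> \<rho>" if "z \<in> X1" for z
    using SUPq[OF that] q0 by (simp add: g_def \<rho>_def norm_divide divide_right_mono)
  have \<rho>: "0 \<le> \<rho>" "\<rho> < 1"
    using order_trans[OF norm_ge_zero g1[OF \<open>0 \<in> X1\<close>]] q q0 by (auto simp: \<rho>_def)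
  obtain M where M: "M \<ge> 0" "\<And>y. y \<in> Y \<Longrightarrow> cmod (g y) \<le> M"
    using approximable_bounded[OF g_approx Y] by blast
  obtain R where R: "R > 0" "\<And>y. y \<in> X1 \<Longrightarrow> norm y \<le> R"
    using compact_imp_bounded[OF cX1] by (auto simp: bounded_pos)
  \<comment> \<open>Lower bound for \<open>f z0\<close> below: the logistic factor has modulus at least \<open>1/2\<close> at \<open>z0\<close>.\<close>
  define \<eta> where "\<eta> = (cmod (z0 $ i))\<^sup>2 / 2"
  have \<eta>: "\<eta> > 0" using i by (simp add: \<eta>_def)
  have "(\<lambda>m. \<rho> ^ m * (R\<^sup>2 + 1 / c)) \<longlonglongrightarrow> 0 * (R\<^sup>2 + 1 / c)"
    using \<rho> by (intro tendsto_mult tendsto_const LIMSEQ_realpow_zero) auto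
  then have "\<forall>\<^sub>F m in sequentially. \<rho> ^ m * (R\<^sup>2 + 1 / c) < \<eta>"
    using \<eta> by (intro order_tendstoD) auto
  then obtain m where m: "\<rho> ^ m * (R\<^sup>2 + 1 / c) < \<eta>"
    using eventually_happens by force
  obtain N0 where N0: "M ^ m * (1 / c) / \<eta> < real N0" using reals_Archimedean2 by blast
  define N where "N = real (Suc N0)"
  have N: "N \<ge> 1" "M ^ m * (1 / (N * c)) < \<eta>"
  proof -
    show "N \<ge> 1" by (simp add: N_def)
    have "M ^ m * (1 / c) / \<eta> < N" using N0 by (simp add: N_def)
    then show "M ^ m * (1 / (N * c)) < \<eta>" using \<eta> c \<open>N \<ge> 1\<close> by (simp add: field_simps)
  qed
  define F where "F t z = 1 + exp (- (of_real t * ?p z))" for t z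
  have F_approx: "approximable Y (F t)" for t
    unfolding F_def
    by (intro approximable_add approximable_const approximable_exp approximable_uminus
        approximable_mult approximable_eval Y)
  have inv: "approximable Y (\<lambda>z. inverse (F N z)) \<and> (\<forall>y\<in>Y. F N y \<noteq> 0)"
  proof (rule approximable_inverse_path[OF hull, folded Y_def])
    show "continuous_on ({0..N} \<times> X) (\<lambda>(t, x). F t x)"
      unfolding F_def case_prod_beta
      by (intro continuous_intros continuous_on_compose2[OF continuous_on_eval_cpoly[of UNIV]]) auto
    show "F t x \<noteq> 0" if "t \<in> {0..N}" "x \<in> X" for t x
    proof -
      have "x = 0 \<or> Re (?p x) \<noteq> 0"
      proof (cases "x = 0")
        case False
        then have "c * (norm x)\<^sup>2 > 0" using c by simp
        then show ?thesis using \<open>x \<in> X\<close> left[of x] right[of x] by (auto simp: X_def)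
      qed simp
      then have "Re (of_real t * ?p x) \<noteq> 0 \<or> of_real t * ?p x = 0" using P0 by auto
      then show ?thesis unfolding F_def by (rule one_plus_exp_nonzero)
    qed
    show "approximable Y (\<lambda>z. inverse (F 0 z))"
      unfolding F_def by simp (rule approximable_const)
    show "F 0 z0 \<noteq> 0" by (simp add: F_def)
  qed (use N F_approx in auto)
  define f where "f z = g z ^ m * ((z $ i)\<^sup>2 * inverse (F N z))" for z
  have f_approx: "approximable Y f"
    unfolding f_def
    by (intro approximable_mult approximable_power approximable_coord g_approx conjunct1[OF inv] Y)
  have "cmod (f z0) \<ge> \<eta>"
  proof -
    have "cmod (F N z0) \<le> 1 + cmod (exp (- (of_real N * ?p z0)))"
      unfolding F_def by (rule order_trans[OF norm_triangle_ineq]) simp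
    also have "\<dots> \<le> 2" using z0(2) N(1) by simp
    finally have "inverse (cmod (F N z0)) \<ge> 1 / 2"
      using inv by (simp add: Y_def field_simps)
    then have "(cmod (z0 $ i))\<^sup>2 * (1 / 2) \<le> (cmod (z0 $ i))\<^sup>2 * inverse (cmod (F N z0))"
      by (intro mult_left_mono) auto
    then show ?thesis by (simp add: f_def g0 \<eta>_def norm_mult norm_inverse norm_power)
  qed
  define r where "r = max (\<rho> ^ m * (R\<^sup>2 + 1 / c)) (M ^ m * (1 / (N * c)))"
  have fX: "cmod (f x) \<le> r" if "x \<in> X" for x
  proof (cases "x = 0")
    case True
    have "\<rho> ^ m * (R\<^sup>2 + 1 / c) \<ge> 0" using \<rho> c by simp
    then show ?thesis using True by (simp add: f_def r_def le_max_iff_disj)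
  next
    case False
    define s where "s = (norm x)\<^sup>2"
    have s: "s > 0" using False by (simp add: s_def)
    have xi: "(cmod (x $ i))\<^sup>2 \<le> s"
      unfolding s_def by (intro power_mono Finite_Cartesian_Product.norm_nth_le) auto
    have Nc: "N * c > 0" using N c by simp
    have fle: "cmod (f x) \<le> cmod (g x) ^ m * (s * inverse (cmod (F N x)))"
      unfolding f_def norm_mult norm_inverse norm_power
      using xi by (intro mult_left_mono mult_right_mono) auto
    from \<open>x \<in> X\<close> consider "x \<in> X1" | "x \<in> X2" by (auto simp: X_def)
    then show ?thesis
    proof cases
      case 1
      \<comment> \<open>The bound \<open>1 - exp (- \<tau>) \<ge> \<tau> / (1 + \<tau>)\<close> vanishes at \<open>\<tau> = 0\<close> to first order only, which the
        factor \<open>s\<close> absorbs.\<close>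
      define \<tau> where "\<tau> = N * c * s"
      have \<tau>: "\<tau> > 0" using Nc s by (simp add: \<tau>_def)
      have "cmod (F N x) \<ge> 1 - exp (- (N * Re (?p x)))"
        using one_plus_exp_right[of "of_real N * ?p x"] by (simp add: F_def)
      moreover have "exp (- (N * Re (?p x))) \<le> exp (- \<tau>)"
        using right[OF 1] N(1) by (simp add: \<tau>_def s_def mult.assoc)
      moreover have "exp (- \<tau>) \<le> 1 / (1 + \<tau>)"
        using exp_ge_add_one_self[of \<tau>] \<tau> by (simp add: exp_minus field_simps)
      moreover have "1 - 1 / (1 + \<tau>) = \<tau> / (1 + \<tau>)" using \<tau> by (simp add: field_simps)
      ultimately have "cmod (F N x) \<ge> \<tau> / (1 + \<tau>)" by linarith
      then have "inverse (cmod (F N x)) \<le> inverse (\<tau> / (1 + \<tau>))"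
        using \<tau> by (intro le_imp_inverse_le) auto
      then have "s * inverse (cmod (F N x)) \<le> s * inverse (\<tau> / (1 + \<tau>))"
        using s by (intro mult_left_mono) auto
      also have "\<dots> = s + s / \<tau>" using \<tau> by (simp add: field_simps)
      also have "s / \<tau> = 1 / (N * c)" using s by (simp add: \<tau>_def)
      also have "s + 1 / (N * c) \<le> R\<^sup>2 + 1 / c"
      proof (rule add_mono)
        show "s \<le> R\<^sup>2" unfolding s_def using R(2)[OF 1] by (intro power_mono) auto
        show "1 / (N * c) \<le> 1 / c" using N c by (intro divide_left_mono) auto
      qed
      finally have "s * inverse (cmod (F N x)) \<le> R\<^sup>2 + 1 / c" .
      then have "cmod (g x) ^ m * (s * inverse (cmod (F N x))) \<le> \<rho> ^ m * (R\<^sup>2 + 1 / c)"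
        using g1[OF 1] s by (intro mult_mono power_mono) (auto simp: \<rho>)
      then show ?thesis using fle by (simp add: r_def)
    next
      case 2
      have le: "N * Re (?p x) \<le> - (N * c * s)"
        using mult_left_mono[OF left[OF 2], of N] N(1) by (simp add: s_def mult_ac)
      moreover have "N * c * s > 0" using Nc s by simp
      ultimately have "cmod (F N x) \<ge> exp (- (N * Re (?p x))) - 1"
        using one_plus_exp_left[of "of_real N * ?p x"] by (simp add: F_def)
      moreover have "exp (- (N * Re (?p x))) \<ge> 1 + (- (N * Re (?p x)))" by (rule exp_ge_add_one_self)
      ultimately have "cmod (F N x) \<ge> N * c * s" using le by linarith
      then have "s * inverse (cmod (F N x)) \<le> s * inverse (N * c * s)"
        using s Nc by (intro mult_left_mono le_imp_inverse_le) auto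
      also have "\<dots> = 1 / (N * c)" using s Nc by (simp add: field_simps)
      finally have "cmod (g x) ^ m * (s * inverse (cmod (F N x))) \<le> M ^ m * (1 / (N * c))"
        using M s \<open>x \<in> X\<close> by (intro mult_mono power_mono) (auto simp: Y_def)
      then show ?thesis using fle by (simp add: r_def)
    qed
  qed
  have "cmod (f z0) \<le> r"
    using approximable_bound_on_hull[OF hull f_approx[unfolded Y_def] fX] .
  moreover have "r < \<eta>" using m N(2) by (simp add: r_def)
  ultimately show False using \<open>cmod (f z0) \<ge> \<eta>\<close> by linarith
qed

lemma eval_cpoly_uminus: "eval_cpoly (- P) z = - eval_cpoly P z"
  using eval_cpoly_add[of P "- P" z] by (simp add: eq_neg_iff_add_eq_0 add.commute)

text \<open>
  The previous lemma applies to \<open>P\<close> or to \<open>- P\<close>, according to the sign of \<open>Re P\<close> at the hull point.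
\<close>
lemma kallin_union:
  fixes X1 X2 :: "(complex ^ 'n::finite) set" and P :: "'n cpoly"
  assumes X1: "polynomially_convex_compact X1" and X2: "polynomially_convex_compact X2"
    and "0 \<in> X1" "0 \<in> X2"
    and c: "c > 0" and P0: "eval_cpoly P 0 = 0"
    and right: "\<And>z. z \<in> X1 \<Longrightarrow> Re (eval_cpoly P z) \<ge> c * (norm z)\<^sup>2"
    and left: "\<And>z. z \<in> X2 \<Longrightarrow> Re (eval_cpoly P z) \<le> - c * (norm z)\<^sup>2"
  shows "polynomially_convex_compact (X1 \<union> X2)"
proof (rule polynomially_convex_compactI)
  have comp: "compact X1" "compact X2"
    using X1 X2 by (auto simp: polynomially_convex_compact_def)
  then show "compact (X1 \<union> X2)" by blast
  fix z assume z: "z \<in> polynomial_hull (X1 \<union> X2)"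
  show "z \<in> X1 \<union> X2"
  proof (cases "Re (eval_cpoly P z) \<ge> 0")
    case True
    then show ?thesis
      using hull_point_in_one_part[OF X1 comp(2) assms(3,4) c P0 right left z] by blast
  next
    case False
    have z': "z \<in> polynomial_hull (X2 \<union> X1)" using z by (simp add: Un_commute)
    have "z \<in> X2"
      by (rule hull_point_in_one_part[OF X2 comp(1) assms(4,3) c, of "- P" z])
         (use False P0 left right z' in \<open>fastforce simp: eval_cpoly_uminus\<close>)+
    then show ?thesis by blast
  qed
qed

section \<open>Compact pieces of Lipschitz graphs\<close>

lemma norm_power2_vec: "(norm (x :: real ^ 'n::finite))\<^sup>2 = (\<Sum>i\<in>UNIV. x $ i * x $ i)"
  by (simp only: power2_norm_eq_inner inner_vec_def inner_real_def)

lemma Re_sum_squares: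
  fixes x y :: "real ^ 'n::finite"
  shows "Re (\<Sum>i\<in>UNIV. ((cvec x + \<i> *s cvec y) $ i)\<^sup>2) = (norm x)\<^sup>2 - (norm y)\<^sup>2"
  unfolding norm_power2_vec by (simp add: cvec_def power2_eq_square sum_subtractf)

lemma cvec_parts:
  fixes w :: "complex ^ 'n::finite"
  shows "cvec (\<chi> i. Re (w $ i)) + \<i> *s cvec (\<chi> i. Im (w $ i)) = w"
  by (simp add: vec_eq_iff cvec_def complex_eq_iff)

lemma cvec_zero: "cvec 0 = 0"
  by (simp add: vec_eq_iff cvec_def)

lemma cvec_diff: "cvec (x - y) = cvec x - cvec y"
  by (simp add: vec_eq_iff cvec_def)

text \<open>
  In the coordinates \<open>D z\<close>, let \<open>a\<close> be the real part of the hull point and \<open>c\<close> the point of the graph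
  above \<open>a\<close>. The entire function \<open>f = exp (- \<Sum> (D z - c)\<^sup>2)\<close> has modulus
  \<open>exp (\<bar>\<psi> x - \<psi> a\<bar>\<^sup>2 - \<bar>x - a\<bar>\<^sup>2)\<close> at the graph point above \<open>x\<close>. Since the Lipschitz constant is below
  one, this modulus is at most one, with equality only at \<open>c\<close>. At \<open>a + \<i> b\<close> the modulus is
  \<open>exp (\<bar>b - \<psi> a\<bar>\<^sup>2)\<close>. So the hull point lies on the graph, and \<open>f\<close> peaks there.
\<close>
lemma compact_in_graph_polynomially_convex:
  fixes \<psi> :: "real ^ 'n::finite \<Rightarrow> real ^ 'n" and D :: "complex ^ 'n ^ 'n"
  assumes X: "compact X" "X \<noteq> {}" and \<alpha>: "\<alpha> < 1"
    and lip: "\<And>x x'. norm (\<psi> x - \<psi> x') \<le> \<alpha> * norm (x - x')"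
    and inj: "inj ((*v) D)" and graph: "\<And>z. z \<in> X \<Longrightarrow> D *v z \<in> real_graph \<psi>"
  shows "polynomially_convex_compact X"
proof (rule polynomially_convex_compactI[OF X(1)])
  fix z0 assume z0: "z0 \<in> polynomial_hull X"
  define a b where "a = (\<chi> i. Re ((D *v z0) $ i))" and "b = (\<chi> i. Im ((D *v z0) $ i))"
  define c where "c = cvec a + \<i> *s cvec (\<psi> a)"
  define f where "f z = exp (- (\<Sum>i\<in>UNIV. ((D *v z) $ i - c $ i)\<^sup>2))" for z
  have Dz0: "D *v z0 = cvec a + \<i> *s cvec b" by (simp only: a_def b_def cvec_parts)
  have Y: "compact (insert z0 X)" using X by simp
  have f_approx: "approximable (insert z0 X) f"
    unfolding f_def matrix_vector_mult_def
    by (simp only: vec_lambda_beta)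
       (intro approximable_exp approximable_uminus approximable_sum approximable_power
        approximable_diff approximable_mult approximable_const approximable_coord Y)
  have f_norm: "cmod (f z) = exp ((norm (y - \<psi> a))\<^sup>2 - (norm (x - a))\<^sup>2)"
    if "D *v z = cvec x + \<i> *s cvec y" for z x y
  proof -
    have "D *v z - c = cvec (x - a) + \<i> *s cvec (y - \<psi> a)"
      by (simp add: that c_def cvec_diff vector_ssub_ldistrib)
    then have "\<And>i. (D *v z) $ i - c $ i = (cvec (x - a) + \<i> *s cvec (y - \<psi> a)) $ i"
      by (metis vector_minus_component)
    then have "Re (\<Sum>i\<in>UNIV. ((D *v z) $ i - c $ i)\<^sup>2) = (norm (x - a))\<^sup>2 - (norm (y - \<psi> a))\<^sup>2"
      by (simp only: Re_sum_squares)
    then show ?thesis by (simp only: f_def norm_exp_eq_Re uminus_complex.sel minus_diff_eq)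
  qed
  have fX: "cmod (f z) \<le> 1" "D *v z \<noteq> c \<Longrightarrow> cmod (f z) < 1" if z: "z \<in> X" for z
  proof -
    obtain x where x: "D *v z = cvec x + \<i> *s cvec (\<psi> x)"
      using graph[OF z] by (auto simp: real_graph_def)
    have "\<alpha> * norm (x - a) \<le> 1 * norm (x - a)" using \<alpha> by (intro mult_right_mono) auto
    then have "norm (\<psi> x - \<psi> a) \<le> norm (x - a)" using lip[of x a] by linarith
    then show "cmod (f z) \<le> 1" by (simp add: f_norm[OF x])
    assume "D *v z \<noteq> c"
    then have "x \<noteq> a" using x by (auto simp: c_def)
    then have "\<alpha> * norm (x - a) < 1 * norm (x - a)" using \<alpha> by (intro mult_strict_right_mono) auto
    then have "norm (\<psi> x - \<psi> a) < norm (x - a)" using lip[of x a] by linarith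
    then have "(norm (\<psi> x - \<psi> a))\<^sup>2 < (norm (x - a))\<^sup>2" by (intro power_strict_mono) auto
    then show "cmod (f z) < 1" by (simp add: f_norm[OF x])
  qed
  have "cmod (f z0) \<le> 1" using approximable_bound_on_hull[OF z0 X f_approx] fX(1) by blast
  then have "b = \<psi> a" by (simp add: f_norm[OF Dz0])
  then have Dz0c: "D *v z0 = c" and f0: "cmod (f z0) = 1" using f_norm[OF Dz0] by (simp_all add: Dz0 c_def)
  show "z0 \<in> X"
  proof (rule ccontr)
    assume "z0 \<notin> X"
    then have lt: "cmod (f z) < 1" if "z \<in> X" for z
      using fX(2)[OF that] that Dz0c injD[OF inj, of z z0] by auto
    have "continuous_on X (\<lambda>z. cmod (f z))"
      unfolding f_def matrix_vector_mult_def by (simp only: vec_lambda_beta) (intro continuous_intros)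
    then obtain z1 where z1: "z1 \<in> X" "\<And>z. z \<in> X \<Longrightarrow> cmod (f z) \<le> cmod (f z1)"
      using continuous_attains_sup[OF X] by blast
    have "cmod (f z0) \<le> cmod (f z1)" using approximable_bound_on_hull[OF z0 X f_approx z1(2)] .
    then show False using f0 lt[OF z1(1)] by simp
  qed
qed

section \<open>Quadratic forms near real subspaces\<close>

definition bform :: "complex ^ 'n ^ 'n \<Rightarrow> complex ^ 'n \<Rightarrow> complex ^ 'n::finite \<Rightarrow> complex" where
  "bform S u v = (\<Sum>i\<in>UNIV. u $ i * (S *v v) $ i)"

lemma bilinear_bform: "bilinear (bform S)"
  unfolding bilinear_def bform_def
  by (auto simp: linear_iff algebra_simps sum.distrib matrix_vector_mult_def simp flip: scaleR_sum_right)

lemma bform_congruence: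
  "bform (transpose B ** S ** B) u v = bform S (B *v u) (B *v v)"
proof -
  have "(\<Sum>i\<in>UNIV. u $ i * (transpose B *v w) $ i) = (\<Sum>j\<in>UNIV. (B *v u) $ j * w $ j)" for w
    by (simp add: matrix_vector_mult_def transpose_def sum_distrib_left sum_distrib_right mult_ac
        del: transpose_matrix_vector) (rule sum.swap)
  then show ?thesis
    by (simp add: bform_def matrix_vector_mul_assoc[symmetric] del: transpose_matrix_vector)
qed

lemma bform_is_polynomial: "\<exists>P. \<forall>z. eval_cpoly P z = bform S z z"
proof -
  let ?X = "\<lambda>i. Poly_Mapping.single (Poly_Mapping.single i 1) 1"
  have "eval_cpoly (\<Sum>i\<in>UNIV. ?X i * (\<Sum>j\<in>UNIV. Poly_Mapping.single 0 (S $ i $ j) * ?X j)) z = bform S z z" for z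
    by (simp only: eval_cpoly_sum eval_cpoly_mult eval_cpoly_const eval_cpoly_coord
        bform_def matrix_vector_mult_def vec_lambda_beta)
  then show ?thesis by blast
qed

lemma norm_cvec: "norm (cvec x) = norm (x :: real ^ 'n::finite)"
  by (simp add: norm_vec_def cvec_def)

lemma norm_i_smult: "norm (\<i> *s (w :: complex ^ 'n::finite)) = norm w"
  by (simp add: norm_vec_def norm_mult)

text \<open>
  The set \<open>\<bar>y\<bar> \<le> \<alpha> \<bar>x\<bar>\<close> is a thin cone around the real subspace that contains every graph over it
  through the origin with Lipschitz constant \<open>\<alpha>\<close>. A strict inequality between quadratic forms
  persists on it.
\<close>
lemma coercive_near_real:
  fixes S :: "complex ^ 'n ^ 'n::finite"
  assumes c: "c > 0" and S: "\<And>x. Re (bform S (cvec x) (cvec x)) \<ge> c * (norm x)\<^sup>2"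
  obtains \<alpha> where "0 < \<alpha>" "\<alpha> < 1" "\<And>x y. norm y \<le> \<alpha> * norm x \<Longrightarrow>
    Re (bform S (cvec x + \<i> *s cvec y) (cvec x + \<i> *s cvec y)) \<ge> c / 8 * (norm (cvec x + \<i> *s cvec y))\<^sup>2"
proof -
  obtain K where K: "K > 0" "\<And>u v. cmod (bform S u v) \<le> K * norm u * norm v"
    using bilinear_bounded_pos[OF bilinear_bform[of S]] by blast
  define \<alpha> where "\<alpha> = min (1 / 2) (c / (6 * K))"
  have \<alpha>: "0 < \<alpha>" "\<alpha> < 1" "\<alpha> \<le> 1" "6 * K * \<alpha> \<le> c"
    using c K(1) by (auto simp: \<alpha>_def min_def field_simps)
  show thesis
  proof (rule that[OF \<alpha>(1,2)])
    fix x y :: "real ^ 'n" assume y: "norm y \<le> \<alpha> * norm x"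
    let ?u = "cvec x" and ?v = "\<i> *s cvec y"
    have yx: "norm y \<le> norm x"
      using y mult_right_mono[OF \<alpha>(3), of "norm x"] by simp
    have small: "K * norm x * norm y \<le> K * \<alpha> * (norm x)\<^sup>2"
      using mult_left_mono[OF y, of "K * norm x"] K(1) by (simp add: power2_eq_square mult_ac)
    have "K * norm y * norm y \<le> K * norm x * norm y"
      using yx K(1) by (intro mult_right_mono mult_left_mono) auto
    then have "cmod (bform S ?u ?v) \<le> K * \<alpha> * (norm x)\<^sup>2" "cmod (bform S ?v ?u) \<le> K * \<alpha> * (norm x)\<^sup>2"
        "cmod (bform S ?v ?v) \<le> K * \<alpha> * (norm x)\<^sup>2"
      using K(2)[of ?u ?v] K(2)[of ?v ?u] K(2)[of ?v ?v] small
      by (simp_all add: norm_cvec norm_i_smult mult_ac)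
    then have rest: "Re (bform S ?u ?v) \<ge> - (K * \<alpha> * (norm x)\<^sup>2)" "Re (bform S ?v ?u) \<ge> - (K * \<alpha> * (norm x)\<^sup>2)"
        "Re (bform S ?v ?v) \<ge> - (K * \<alpha> * (norm x)\<^sup>2)"
      using abs_Re_le_cmod by (smt (verit))+
    have "bform S (?u + ?v) (?u + ?v) = bform S ?u ?u + bform S ?u ?v + bform S ?v ?u + bform S ?v ?v"
      by (simp add: bilinear_ladd[OF bilinear_bform] bilinear_radd[OF bilinear_bform])
    then have "Re (bform S (?u + ?v) (?u + ?v)) \<ge> c * (norm x)\<^sup>2 - 3 * K * \<alpha> * (norm x)\<^sup>2"
      using S[of x] rest by simp
    moreover have "6 * K * \<alpha> * (norm x)\<^sup>2 \<le> c * (norm x)\<^sup>2"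
      using \<alpha>(4) by (intro mult_right_mono) auto
    moreover have "(norm (?u + ?v))\<^sup>2 \<le> 4 * (norm x)\<^sup>2"
    proof -
      have "norm (?u + ?v) \<le> 2 * norm x"
        using norm_triangle_ineq[of ?u ?v] yx by (simp add: norm_cvec norm_i_smult)
      then have "(norm (?u + ?v))\<^sup>2 \<le> (2 * norm x)\<^sup>2" by (intro power_mono) auto
      then show ?thesis by (simp add: power_mult_distrib)
    qed
    then have "c / 8 * (norm (?u + ?v))\<^sup>2 \<le> c / 8 * (4 * (norm x)\<^sup>2)"
      using c by (intro mult_left_mono) auto
    ultimately show "Re (bform S (?u + ?v) (?u + ?v)) \<ge> c / 8 * (norm (?u + ?v))\<^sup>2" by simp
  qed
qed

section \<open>The separating quadratic polynomial\<close>

lemma cmat_mult_cvec: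
  fixes P :: "real ^ 'n::finite ^ 'm"
  shows "cmat P *v (cvec s + \<i> *s cvec x) = cvec (P *v s) + \<i> *s cvec (P *v x)"
  by (simp add: vec_eq_iff cmat_def map_matrix_def cvec_def matrix_vector_mult_def
      algebra_simps sum.distrib sum_distrib_left)

lemma mat_mult_vec: "mat c *v (w :: 'a::comm_semiring_1 ^ 'n::finite) = c *s w"
  by (simp add: vec_eq_iff matrix_vector_mult_def mat_def if_distrib[of "\<lambda>x. x * _"] cong: if_cong)

lemma Re_bform:
  fixes P Q :: "real ^ 'n ^ 'n::finite"
  shows "Re (bform (cmat P + mat \<i> ** cmat Q) (cvec s + \<i> *s cvec x) (cvec s + \<i> *s cvec x)) =
    s \<bullet> (P *v s) - x \<bullet> (P *v x) - s \<bullet> (Q *v x) - x \<bullet> (Q *v s)"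
proof -
  have "(cmat P + mat \<i> ** cmat Q) *v (cvec s + \<i> *s cvec x) =
      cvec (P *v s) + \<i> *s cvec (P *v x) + \<i> *s (cvec (Q *v s) + \<i> *s cvec (Q *v x))"
    by (simp add: matrix_vector_mult_add_rdistrib cmat_mult_cvec mat_mult_vec
        flip: matrix_vector_mul_assoc)
  then show ?thesis
    unfolding bform_def by (simp only:) (simp add: cvec_def inner_vec_def algebra_simps sum.distrib sum_subtractf)
qed

lemma cayley_hamilton_2:
  fixes A :: "real ^ 2 ^ 2"
  shows "A *v (A *v x) = trace A *\<^sub>R (A *v x) - det A *\<^sub>R x"
  by (simp add: vec_eq_iff forall_2 trace_def sum_2 det_2 matrix_vector_mult_def algebra_simps)

lemma inner_transpose_left: "x \<bullet> (transpose M *v y) = (M *v x) \<bullet> (y :: real ^ 'n::finite)"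
  by (metis dot_lmul_matrix inner_commute transpose_matrix_vector)

text \<open>
  The first inequality says that \<open>P\<close> is positive, the second that
  \<open>P + (A\<^sup>T Q + Q A) - A\<^sup>T P A\<close> is positive. If \<open>A\<close> has no eigenvalue on the imaginary axis, the
  Lyapunov part \<open>A\<^sup>T Q + Q A\<close> can be made positive and as large as desired, so that \<open>P = 1\<close> works. If
  the eigenvalues are imaginary of modulus below one, \<open>A\<close> is a contraction for a suitable metric \<open>P\<close>
  and \<open>Q = 0\<close> works. The remaining case has the simple eigenvalue zero: there the Lyapunov part is
  needed only where \<open>A x\<close> is nonzero. In dimension two the Cayley-Hamilton identity
  \<open>A\<^sup>2 = t A - d\<close> yields explicit matrices in terms of the trace \<open>t\<close> and the determinant \<open>d\<close>.
\<close>
lemma lyapunov_stein_matrices: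
  fixes A :: "real ^ 2 ^ 2"
  assumes "\<not> (trace A = 0 \<and> det A \<ge> 1)"
  obtains P Q :: "real ^ 2 ^ 2" and c where "c > 0"
    "\<And>x. x \<bullet> (P *v x) \<ge> c * (norm x)\<^sup>2"
    "\<And>x. x \<bullet> (P *v x) + (A *v x) \<bullet> (Q *v x) + x \<bullet> (Q *v (A *v x)) - (A *v x) \<bullet> (P *v (A *v x))
       \<ge> c * (norm x)\<^sup>2"
proof -
  let ?t = "trace A" and ?d = "det A"
  note ch = cayley_hamilton_2[of A]
  note mv = mat_mult_vec scalar_mult_eq_scaleR matrix_vector_mult_add_rdistrib matrix_vector_mult_diff_rdistrib
    inner_add_left inner_add_right inner_diff_left inner_diff_right inner_transpose_left
    matrix_vector_mul_assoc[symmetric]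
  consider "?t = 0" "0 \<le> ?d" "?d < 1" | "?t = 0" "?d < 0" | "?t \<noteq> 0" "?d \<noteq> 0" | "?t \<noteq> 0" "?d = 0"
    using assms by linarith
  then show thesis
  proof cases
    case 1
    \<comment> \<open>For \<open>P = \<epsilon> + A\<^sup>T A\<close> the difference \<open>P - A\<^sup>T P A\<close> is
      \<open>(\<epsilon> - d\<^sup>2) + (1 - \<epsilon>) A\<^sup>T A\<close>, so any \<open>\<epsilon>\<close> strictly between \<open>d\<^sup>2\<close> and \<open>1\<close> serves.\<close>
    define \<epsilon> where "\<epsilon> = (1 + ?d\<^sup>2) / 2"
    have d2: "?d\<^sup>2 < 1" using 1 by (simp add: power_less_one_iff abs_square_less_1)
    have e: "\<epsilon> > 0" "\<epsilon> - ?d\<^sup>2 > 0" "1 - \<epsilon> \<ge> 0" using d2 by (auto simp: \<epsilon>_def add_pos_nonneg)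
    show thesis
    proof (rule that[of "\<epsilon> - ?d\<^sup>2" "mat \<epsilon> + transpose A ** A" 0])
      fix x
      have P: "x \<bullet> ((mat \<epsilon> + transpose A ** A) *v x) = \<epsilon> * (norm x)\<^sup>2 + (norm (A *v x))\<^sup>2" for x
        by (simp add: mv power2_norm_eq_inner del: transpose_matrix_vector)
      have AA: "(norm (A *v (A *v x)))\<^sup>2 = ?d\<^sup>2 * (norm x)\<^sup>2"
        by (simp add: ch 1 power_mult_distrib)
      have nonneg: "0 \<le> ?d\<^sup>2 * (norm x)\<^sup>2 + (norm (A *v x))\<^sup>2" by simp
      show "x \<bullet> ((mat \<epsilon> + transpose A ** A) *v x) \<ge> (\<epsilon> - ?d\<^sup>2) * (norm x)\<^sup>2"
        unfolding P left_diff_distrib using nonneg by linarith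
      have "(1 - \<epsilon>) * (norm (A *v x))\<^sup>2 \<ge> 0" using e(3) by simp
      then show "x \<bullet> ((mat \<epsilon> + transpose A ** A) *v x) + (A *v x) \<bullet> (0 *v x) + x \<bullet> (0 *v (A *v x)) -
          (A *v x) \<bullet> ((mat \<epsilon> + transpose A ** A) *v (A *v x)) \<ge> (\<epsilon> - ?d\<^sup>2) * (norm x)\<^sup>2"
        unfolding P AA by (simp add: algebra_simps)
    qed (use e in auto)
  next
    case 2
    \<comment> \<open>Here \<open>A\<^sup>2 = - d\<close> is a positive scalar matrix, and \<open>A\<^sup>T Q + Q A\<close> has the quadratic form of
      \<open>A\<^sup>T A + A\<^sup>2\<close>.\<close>
    define Q where "Q = mat (1 / 2) ** (A + transpose A)"
    show thesis
    proof (rule that[of 1 "mat 1" Q])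
      fix x
      have "(A *v x) \<bullet> (Q *v x) + x \<bullet> (Q *v (A *v x)) = x \<bullet> (A *v (A *v x)) + (norm (A *v x))\<^sup>2"
        by (simp add: Q_def mv power2_norm_eq_inner inner_commute add_divide_distrib del: transpose_matrix_vector)
      moreover have "x \<bullet> (A *v (A *v x)) = - ?d * (norm x)\<^sup>2"
        by (simp add: ch 2 power2_norm_eq_inner)
      moreover have "- ?d * (norm x)\<^sup>2 \<ge> 0" using 2 by (simp add: mult_nonpos_nonneg)
      ultimately show "x \<bullet> (mat 1 *v x) + (A *v x) \<bullet> (Q *v x) + x \<bullet> (Q *v (A *v x)) -
          (A *v x) \<bullet> (mat 1 *v (A *v x)) \<ge> 1 * (norm x)\<^sup>2"
        by (simp add: power2_norm_eq_inner)
    qed (auto simp: power2_norm_eq_inner)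
  next
    case 3
    obtain K where K: "K > 0" "\<And>x. norm (A *v x) \<le> K * norm x"
      using linear_bounded_pos[OF matrix_vector_mul_linear[of A]] by blast
    \<comment> \<open>\<open>C\<close> is the adjugate of \<open>A\<close>, so \<open>C A = d\<close>; this makes the Lyapunov part equal to
      \<open>2 k d t\<close> times the identity, and \<open>k\<close> makes that \<open>K\<^sup>2\<close>, which outweighs \<open>A\<^sup>T A\<close>.\<close>
    define k where "k = K\<^sup>2 / (2 * ?d * ?t)"
    define C where "C = mat ?t - A"
    define Q where "Q = mat k ** (mat ?d + transpose C ** C)"
    show thesis
    proof (rule that[of 1 "mat 1" Q])
      fix x
      have CA: "C *v (A *v x) = ?d *\<^sub>R x" by (simp add: C_def mv ch)
      have "(A *v x) \<bullet> (Q *v x) + x \<bullet> (Q *v (A *v x)) =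
          2 * k * ?d * ((A *v x) \<bullet> x + (C *v x) \<bullet> x)"
        by (simp add: Q_def mv CA inner_commute algebra_simps del: transpose_matrix_vector)
      also have "(A *v x) \<bullet> x + (C *v x) \<bullet> x = ?t * (norm x)\<^sup>2"
        by (simp add: C_def mv power2_norm_eq_inner)
      also have "2 * k * ?d * (?t * (norm x)\<^sup>2) = K\<^sup>2 * (norm x)\<^sup>2"
        using 3 by (simp add: k_def)
      finally have "(A *v x) \<bullet> (Q *v x) + x \<bullet> (Q *v (A *v x)) = K\<^sup>2 * (norm x)\<^sup>2" .
      moreover have "(norm (A *v x))\<^sup>2 \<le> K\<^sup>2 * (norm x)\<^sup>2"
        using power_mono[OF K(2)[of x], of 2] by (simp add: power_mult_distrib)
      ultimately show "x \<bullet> (mat 1 *v x) + (A *v x) \<bullet> (Q *v x) + x \<bullet> (Q *v (A *v x)) -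
          (A *v x) \<bullet> (mat 1 *v (A *v x)) \<ge> 1 * (norm x)\<^sup>2"
        by (simp add: power2_norm_eq_inner)
    qed (auto simp: power2_norm_eq_inner)
  next
    case 4
    \<comment> \<open>Now \<open>A\<^sup>2 = t A\<close>, which makes \<open>A\<^sup>T Q + Q A = A\<^sup>T A\<close> and cancels the negative term exactly.\<close>
    define Q where "Q = mat (1 / (2 * ?t)) ** (transpose A ** A)"
    show thesis
    proof (rule that[of 1 "mat 1" Q])
      fix x
      have "(A *v x) \<bullet> (Q *v x) + x \<bullet> (Q *v (A *v x)) = (norm (A *v x))\<^sup>2"
        using 4 by (simp add: Q_def mv ch power2_norm_eq_inner inner_commute field_simps del: transpose_matrix_vector)
      then show "x \<bullet> (mat 1 *v x) + (A *v x) \<bullet> (Q *v x) + x \<bullet> (Q *v (A *v x)) -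
          (A *v x) \<bullet> (mat 1 *v (A *v x)) \<ge> 1 * (norm x)\<^sup>2"
        by (simp add: power2_norm_eq_inner)
    qed (auto simp: power2_norm_eq_inner)
  qed
qed

text \<open>
  If the trace vanishes, \<open>det A = 1\<close> means that the eigenvalues are \<open>\<plusminus> \<i>\<close>, which invertibility of \<open>A + \<i>\<close>
  excludes; for \<open>det A > 1\<close> they are imaginary of modulus \<open>sqrt (det A)\<close>.
\<close>
lemma trace_det_condition:
  fixes A :: "real ^ 2 ^ 2"
  assumes inv: "invertible (cmat A + mat \<i>)"
    and eig: "\<not> (\<exists>\<mu>. complex_eigenvalue A \<mu> \<and> Re \<mu> = 0 \<and> cmod \<mu> > 1)"
  shows "\<not> (trace A = 0 \<and> det A \<ge> 1)"
proof
  assume td: "trace A = 0 \<and> det A \<ge> 1"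
  have char_poly: "det (cmat A + mat w) = w\<^sup>2 + of_real (trace A) * w + of_real (det A)" for w
    by (simp add: det_2 trace_def sum_2 cmat_def map_matrix_def mat_def power2_eq_square algebra_simps)
  have "det A \<noteq> 1"
    using inv td by (auto simp: invertible_det_nz char_poly)
  then have d: "det A > 1" using td by simp
  define \<mu> where "\<mu> = \<i> * of_real (sqrt (det A))"
  have "\<mu>\<^sup>2 = - of_real (det A)"
    using d by (simp add: \<mu>_def power_mult_distrib flip: of_real_power)
  then have "det (cmat A + mat (- \<mu>)) = 0" using td by (simp add: char_poly)
  then have "\<not> invertible (cmat A + mat (- \<mu>))" by (simp add: invertible_det_nz)
  then obtain v where v: "v \<noteq> 0" "(cmat A + mat (- \<mu>)) *v v = 0"
    by (meson invertible_left_inverse matrix_left_invertible_ker)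
  then have "cmat A *v v = \<mu> *s v"
    by (simp add: matrix_vector_mult_add_rdistrib mat_mult_vec)
  then have "complex_eigenvalue A \<mu>" using v by (auto simp: complex_eigenvalue_def)
  moreover have "Re \<mu> = 0" "cmod \<mu> > 1" using d by (auto simp: \<mu>_def norm_mult)
  ultimately show False using eig by blast
qed

text \<open>
  For \<open>S = P + \<i> Q\<close> the real part of \<open>x\<^sup>T S x\<close> is \<open>x\<^sup>T P x\<close>. At \<open>(A + \<i>) x\<close> it is
  \<open>x\<^sup>T (A\<^sup>T P A - P - A\<^sup>T Q - Q A) x\<close>. These are the two forms controlled by the matrices found
  above.
\<close>
lemma quadratic_separation:
  fixes A :: "real ^ 2 ^ 2"
  assumes "\<not> (trace A = 0 \<and> det A \<ge> 1)"
  obtains S :: "complex ^ 2 ^ 2" and c where "c > 0"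
    "\<And>x. Re (bform S (cvec x) (cvec x)) \<ge> c * (norm x)\<^sup>2"
    "\<And>x. Re (bform S ((cmat A + mat \<i>) *v cvec x) ((cmat A + mat \<i>) *v cvec x)) \<le> - c * (norm x)\<^sup>2"
proof -
  obtain P Q c where c: "c > 0" and P: "\<And>x. x \<bullet> (P *v x) \<ge> c * (norm x)\<^sup>2"
    and Q: "\<And>x. x \<bullet> (P *v x) + (A *v x) \<bullet> (Q *v x) + x \<bullet> (Q *v (A *v x)) - (A *v x) \<bullet> (P *v (A *v x))
       \<ge> c * (norm x)\<^sup>2"
    using lyapunov_stein_matrices[OF assms] by metis
  let ?S = "cmat P + mat \<i> ** cmat Q"
  show thesis
  proof (rule that[OF c, of ?S])
    fix x
    show "Re (bform ?S (cvec x) (cvec x)) \<ge> c * (norm x)\<^sup>2"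
      using Re_bform[of P Q x 0] P[of x] by (simp add: cvec_zero)
    have "(cmat A + mat \<i>) *v cvec x = cvec (A *v x) + \<i> *s cvec x"
      using cmat_mult_cvec[of A x 0]
      by (simp add: matrix_vector_mult_add_rdistrib mat_mult_vec cvec_zero)
    then show "Re (bform ?S ((cmat A + mat \<i>) *v cvec x) ((cmat A + mat \<i>) *v cvec x)) \<le> - c * (norm x)\<^sup>2"
      using Re_bform[of P Q "A *v x" x] Q[of x] by simp
  qed
qed

section \<open>The two graphs\<close>

lemma closed_real_graph:
  fixes \<psi> :: "real ^ 'n::finite \<Rightarrow> real ^ 'n"
  assumes "continuous_on UNIV \<psi>"
  shows "closed (real_graph \<psi>)"
proof -
  have "real_graph \<psi> = {z. (\<chi> i. Im (z $ i)) = \<psi> (\<chi> i. Re (z $ i))}"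
  proof (intro set_eqI iffI; clarsimp)
    show "z \<in> real_graph \<psi>" if "(\<chi> i. Im (z $ i)) = \<psi> (\<chi> i. Re (z $ i))" for z
      using cvec_parts[of z] that unfolding real_graph_def by (metis (mono_tags, lifting) mem_Collect_eq)
  qed (auto simp: real_graph_def cvec_def)
  moreover have "closed {z :: complex ^ 'n. (\<chi> i. Im (z $ i)) = \<psi> (\<chi> i. Re (z $ i))}"
    by (intro closed_Collect_eq continuous_on_compose2[OF assms] continuous_intros continuous_on_vec_lambda) auto
  ultimately show ?thesis by simp
qed

lemma tilted_graph_eq:
  assumes "B' ** (cmat A + mat \<i>) = mat 1" "(cmat A + mat \<i>) ** B' = mat 1"
  shows "tilted_graph A \<psi> = {z. B' *v z \<in> real_graph \<psi>}"
proof -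
  let ?B = "cmat A + mat \<i>"
  have "tilted_graph A \<psi> = ((*v) ?B) ` real_graph \<psi>"
    by (simp add: tilted_graph_def real_graph_def full_SetCompr_eq image_image
        matrix_vector_right_distrib vector_scalar_commute)
  also have "\<dots> = {z. B' *v z \<in> real_graph \<psi>}"
  proof (intro set_eqI iffI)
    fix z assume "z \<in> {z. B' *v z \<in> real_graph \<psi>}"
    moreover have "z = ?B *v (B' *v z)" by (simp add: matrix_vector_mul_assoc assms)
    ultimately show "z \<in> ((*v) ?B) ` real_graph \<psi>" by blast
  qed (auto simp: matrix_vector_mul_assoc assms)
  finally show ?thesis .
qed

lemma lipschitz_continuous:
  fixes \<psi> :: "real ^ 'n::finite \<Rightarrow> real ^ 'n"
  assumes "\<And>x x'. norm (\<psi> x - \<psi> x') \<le> \<alpha> * norm (x - x')" "\<alpha> \<ge> 0"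
  shows "continuous_on UNIV \<psi>"
  by (rule lipschitz_on_continuous_on[of \<alpha>]) (use assms in \<open>auto simp: lipschitz_on_def dist_norm\<close>)

lemma polynomially_convex_exhaustion:
  assumes "closed M" "\<And>m. polynomially_convex_compact (M \<inter> cball 0 (real m))"
  shows "polynomially_convex M"
  unfolding polynomially_convex_def
proof (intro conjI exI[of _ "\<lambda>m. M \<inter> cball 0 (real m)"] allI)
  show "(\<Union>m. M \<inter> cball 0 (real m)) = M" using real_arch_simple by auto
qed (use assms in auto)

theorem theorem1p14:
  fixes A :: "real ^ 2 ^ 2"
  assumes "invertible (cmat A + mat \<i>)"
    and "\<not> (\<exists>\<mu>. complex_eigenvalue A \<mu> \<and> Re \<mu> = 0 \<and> cmod \<mu> > 1)"
  shows "\<exists>\<alpha>\<^sub>1 \<alpha>\<^sub>2 :: real. 0 < \<alpha>\<^sub>1 \<and> \<alpha>\<^sub>1 < 1 \<and> 0 < \<alpha>\<^sub>2 \<and> \<alpha>\<^sub>2 < 1 \<and>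
    (\<forall>\<psi>\<^sub>1 \<psi>\<^sub>2 :: real ^ 2 \<Rightarrow> real ^ 2.
       C1_map \<psi>\<^sub>1 \<longrightarrow> C1_map \<psi>\<^sub>2 \<longrightarrow>
       \<psi>\<^sub>1 0 = 0 \<longrightarrow> \<psi>\<^sub>2 0 = 0 \<longrightarrow>
       (\<forall>x x'. norm (\<psi>\<^sub>1 x - \<psi>\<^sub>1 x') \<le> \<alpha>\<^sub>1 * norm (x - x')) \<longrightarrow>
       (\<forall>x x'. norm (\<psi>\<^sub>2 x - \<psi>\<^sub>2 x') \<le> \<alpha>\<^sub>2 * norm (x - x')) \<longrightarrow>
       real_graph \<psi>\<^sub>1 \<inter> tilted_graph A \<psi>\<^sub>2 = {0} \<longrightarrow>
       polynomially_convex (real_graph \<psi>\<^sub>1 \<union> tilted_graph A \<psi>\<^sub>2))"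
proof -
  let ?B = "cmat A + mat \<i>"
  obtain B' where B': "B' ** ?B = mat 1" "?B ** B' = mat 1"
    using assms(1) by (auto simp: invertible_def)
  obtain S c where c: "c > 0" and S1: "\<And>x. Re (bform S (cvec x) (cvec x)) \<ge> c * (norm x)\<^sup>2"
    and S2: "\<And>x. Re (bform S (?B *v cvec x) (?B *v cvec x)) \<le> - c * (norm x)\<^sup>2"
    using quadratic_separation[OF trace_det_condition[OF assms]] by metis
  \<comment> \<open>The form \<open>- S\<close> pulled back by \<open>A + \<i>\<close> turns the second graph into a graph over the real plane.\<close>
  define S' where "S' = transpose ?B ** (- S) ** ?B"
  have S': "bform S' u u = - bform S (?B *v u) (?B *v u)" for u
  proof -
    have "bform (- S) v v = - bform S v v" for v
      by (simp add: bform_def matrix_vector_mult_def sum_negf)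
    then show ?thesis by (simp add: S'_def bform_congruence)
  qed
  obtain P where P: "\<And>z. eval_cpoly P z = bform S z z" using bform_is_polynomial by metis
  obtain K where K: "K > 0" "\<And>u. norm (?B *v u) \<le> K * norm u"
    using linear_bounded_pos[of "(*v) ?B"] matrix_vector_mul_linear by blast
  obtain \<alpha> where \<alpha>: "0 < \<alpha>" "\<alpha> < 1" and near1: "\<And>x y. norm y \<le> \<alpha> * norm x \<Longrightarrow>
      Re (bform S (cvec x + \<i> *s cvec y) (cvec x + \<i> *s cvec y)) \<ge> c / 8 * (norm (cvec x + \<i> *s cvec y))\<^sup>2"
    using coercive_near_real[OF c S1] by metis
  have "\<And>x. Re (bform S' (cvec x) (cvec x)) \<ge> c * (norm x)\<^sup>2"
    using S2 by (simp add: S' minus_le_iff le_minus_iff)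
  then obtain \<beta> where \<beta>: "0 < \<beta>" "\<beta> < 1" and near2: "\<And>x y. norm y \<le> \<beta> * norm x \<Longrightarrow>
      Re (bform S' (cvec x + \<i> *s cvec y) (cvec x + \<i> *s cvec y)) \<ge> c / 8 * (norm (cvec x + \<i> *s cvec y))\<^sup>2"
    using coercive_near_real[OF c] by metis
  define \<gamma> where "\<gamma> = min (c / 8) (c / 8 / K\<^sup>2)"
  have \<gamma>: "\<gamma> > 0" "\<gamma> \<le> c / 8" "\<gamma> * K\<^sup>2 \<le> c / 8" using c K(1) by (auto simp: \<gamma>_def min_def field_simps)
  have main: "polynomially_convex (real_graph \<psi>\<^sub>1 \<union> tilted_graph A \<psi>\<^sub>2)"
    if zero: "\<psi>\<^sub>1 0 = 0" "\<psi>\<^sub>2 0 = 0" and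
      lip1: "\<And>x x'. norm (\<psi>\<^sub>1 x - \<psi>\<^sub>1 x') \<le> \<alpha> * norm (x - x')" and
      lip2: "\<And>x x'. norm (\<psi>\<^sub>2 x - \<psi>\<^sub>2 x') \<le> \<beta> * norm (x - x')" for \<psi>\<^sub>1 \<psi>\<^sub>2
  proof -
    let ?L1 = "real_graph \<psi>\<^sub>1" and ?L2 = "tilted_graph A \<psi>\<^sub>2"
    have L2: "?L2 = {z. B' *v z \<in> real_graph \<psi>\<^sub>2}" by (rule tilted_graph_eq[OF B'])
    have cl1: "closed ?L1" and "closed (real_graph \<psi>\<^sub>2)"
      using lip1 lip2 \<alpha> \<beta> by (auto intro!: closed_real_graph lipschitz_continuous)
    then have "closed ((*v) B' -` real_graph \<psi>\<^sub>2)"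
      by (intro continuous_closed_vimage) (auto intro: linear_continuous_at)
    then have cl2: "closed ?L2" by (simp add: L2 vimage_def)
    have zero_in: "0 \<in> ?L1" "0 \<in> ?L2"
      using zero by (auto simp: L2 real_graph_def cvec_zero intro!: exI[of _ 0])
    have right: "Re (eval_cpoly P z) \<ge> \<gamma> * (norm z)\<^sup>2" if z: "z \<in> ?L1" for z
    proof -
      obtain x where x: "z = cvec x + \<i> *s cvec (\<psi>\<^sub>1 x)" using z by (auto simp: real_graph_def)
      have "c / 8 * (norm z)\<^sup>2 \<le> Re (eval_cpoly P z)"
        using near1[of "\<psi>\<^sub>1 x" x] lip1[of x 0] zero by (simp add: P x)
      moreover have "\<gamma> * (norm z)\<^sup>2 \<le> c / 8 * (norm z)\<^sup>2" using \<gamma> by (intro mult_right_mono) auto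
      ultimately show ?thesis by linarith
    qed
    have left: "Re (eval_cpoly P z) \<le> - \<gamma> * (norm z)\<^sup>2" if z: "z \<in> ?L2" for z
    proof -
      define u where "u = B' *v z"
      have zu: "z = ?B *v u" by (simp add: u_def matrix_vector_mul_assoc B')
      obtain x where x: "u = cvec x + \<i> *s cvec (\<psi>\<^sub>2 x)" using z by (auto simp: L2 u_def real_graph_def)
      have "c / 8 * (norm u)\<^sup>2 \<le> Re (bform S' u u)"
        using near2[of "\<psi>\<^sub>2 x" x] lip2[of x 0] zero by (simp add: x)
      moreover have "(norm z)\<^sup>2 \<le> K\<^sup>2 * (norm u)\<^sup>2"
        using power_mono[OF K(2)[of u], of 2] by (simp add: zu power_mult_distrib)
      then have "\<gamma> * (norm z)\<^sup>2 \<le> \<gamma> * K\<^sup>2 * (norm u)\<^sup>2" using \<gamma>(1) by (simp add: mult.assoc)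
      moreover have "\<gamma> * K\<^sup>2 * (norm u)\<^sup>2 \<le> c / 8 * (norm u)\<^sup>2" using \<gamma>(3) by (intro mult_right_mono) auto
      ultimately show ?thesis by (simp add: P S' zu)
    qed
    show ?thesis
    proof (rule polynomially_convex_exhaustion)
      show "closed (?L1 \<union> ?L2)" using cl1 cl2 by blast
      fix m
      let ?D = "cball 0 (real m) :: (complex ^ 2) set"
      have "polynomially_convex_compact (?L1 \<inter> ?D)"
        by (rule compact_in_graph_polynomially_convex[where D = "mat 1", OF _ _ \<alpha>(2) lip1])
           (use cl1 zero_in in \<open>auto intro: closed_Int_compact simp: inj_def\<close>)
      moreover have "polynomially_convex_compact (?L2 \<inter> ?D)"
      proof (rule compact_in_graph_polynomially_convex[where D = B', OF _ _ \<beta>(2) lip2])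
        show "inj ((*v) B')"
          by (rule inj_on_inverseI[of _ "(*v) ?B"]) (simp add: matrix_vector_mul_assoc B')
        show "?L2 \<inter> ?D \<noteq> {}" using zero_in by auto
      qed (use cl2 L2 in \<open>auto intro: closed_Int_compact\<close>)
      ultimately have "polynomially_convex_compact ((?L1 \<inter> ?D) \<union> (?L2 \<inter> ?D))"
        by (rule kallin_union[OF _ _ _ _ \<gamma>(1), of _ _ P])
           (use zero_in right left in \<open>auto simp: P bform_def\<close>)
      then show "polynomially_convex_compact ((?L1 \<union> ?L2) \<inter> ?D)" by (simp add: Int_Un_distrib2)
    qed
  qed
  show ?thesis using \<alpha> \<beta> main by (intro exI[of _ \<alpha>] exI[of _ \<beta>]) auto
qed

end
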